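(* For every integer $x_0\ge1$ and every $m\in\mathbb{N}$, $$P(w,m)=\#\{\,x_n\bmod 2^m : n\ge0\,\},$$ where $(x_n)_{n\ge0}$ and $w$ are the orbit and the word associated with $x_0$.
   Context: Here $\mathbb{N}=\{0,1,2,\dots\}$. For an integer $x_0\ge1$ the orbit is defined by $x_{n+1}=\lceil 3x_n/2\rceil$ for $n\ge0$, and the word $w=(w_n)_{n\ge0}$ by $w_n=x_n\bmod 2\in\{0,1\}$; equivalently $w_n=2x_{n+1}-3x_n$. The complexity $P(w,m)$ is the number of distinct vectors $(w_j,w_{j+1},\dots,w_{j+m-1})$ as $j$ ranges over all non-negative integers. *)

theory Defs
  imports Complex_Main
begin

primrec orbit :: "int \<Rightarrow> nat \<Rightarrow> int" where
  "orbit x0 0 = x0"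
| "orbit x0 (Suc n) = \<lceil>3 * real_of_int (orbit x0 n) / 2\<rceil>"

definition parity_word :: "int \<Rightarrow> nat \<Rightarrow> int" where
  "parity_word x0 n = orbit x0 n mod 2"

(* The vector (w_j, ..., w_(j+m-1)), as a list of length m. *)
definition factor :: "(nat \<Rightarrow> 'a) \<Rightarrow> nat \<Rightarrow> nat \<Rightarrow> 'a list" where
  "factor w m j = map w [j..<j + m]"

(* Since card is 0 on infinite sets, this is meaningful only for words with finitely many
   factors of each length, in particular for words over a finite alphabet such as parity_word. *)
definition complexity :: "(nat \<Rightarrow> 'a) \<Rightarrow> nat \<Rightarrow> nat" where
  "complexity w m = card {factor w m j | j. True}"

end

theory Submission
  imports Defs
begin

text \<open>
  Two positions carry the same factor of length \<open>m\<close> iff their orbit values agree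
  modulo \<open>2 ^ m\<close>, so both sides count the classes of one equivalence relation on positions.
  The equivalence is an induction on \<open>m\<close>: if \<open>x\<^sub>i\<close> and \<open>x\<^sub>j\<close> have the same parity, then
  \<open>2 (x\<^bsub>i+1\<^esub> - x\<^bsub>j+1\<^esub>) = 3 (x\<^sub>i - x\<^sub>j)\<close>, and \<open>3\<close> is invertible modulo powers of \<open>2\<close>.
\<close>

text \<open>The recursion freed of the ceiling, so that divisibility arguments apply to it.\<close>

lemma two_times_orbit_Suc:
  "2 * orbit x0 (Suc n) = 3 * orbit x0 n + parity_word x0 n"
proof (cases "even (orbit x0 n)")
  case True
  then obtain k where k: "orbit x0 n = 2 * k" by blast
  have "\<lceil>3 * real_of_int (2 * k) / 2\<rceil> = 3 * k"
    by (rule ceiling_unique) auto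
  then show ?thesis by (simp add: k parity_word_def)
next
  case False
  then obtain k where k: "orbit x0 n = 2 * k + 1" by (rule oddE)
  have "\<lceil>3 * real_of_int (2 * k + 1) / 2\<rceil> = 3 * k + 2"
    by (rule ceiling_unique) auto
  then show ?thesis by (simp add: k parity_word_def)
qed

lemma factor_Suc: "factor w (Suc m) j = w j # factor w m (Suc j)"
  by (simp add: factor_def upt_conv_Cons del: upt_Suc)

lemma orbit_mod_Suc_iff:
  "orbit x0 i mod 2 ^ Suc m = orbit x0 j mod 2 ^ Suc m \<longleftrightarrow>
    parity_word x0 i = parity_word x0 j \<and>
    orbit x0 (Suc i) mod 2 ^ m = orbit x0 (Suc j) mod 2 ^ m"
proof (cases "parity_word x0 i = parity_word x0 j")
  case True
  have eq: "2 * (orbit x0 (Suc i) - orbit x0 (Suc j)) = 3 * (orbit x0 i - orbit x0 j)"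
    using two_times_orbit_Suc[of x0 i] two_times_orbit_Suc[of x0 j] True
    by (simp only: right_diff_distrib)
  have "coprime (2 ^ Suc m :: int) 3"
    by (rule coprime_power_left_iff[THEN iffD2]) simp
  then have "2 ^ Suc m dvd orbit x0 i - orbit x0 j \<longleftrightarrow>
      2 ^ Suc m dvd 3 * (orbit x0 i - orbit x0 j)"
    by (simp only: coprime_dvd_mult_right_iff)
  \<comment> \<open>By \<open>eq\<close> the product is twice the difference of the successors;
    cancelling this 2 lowers the exponent by one.\<close>
  also have "\<dots> \<longleftrightarrow> 2 ^ m dvd orbit x0 (Suc i) - orbit x0 (Suc j)"
    unfolding eq[symmetric] power_Suc by (rule dvd_mult_cancel_left[THEN trans]) simp
  finally show ?thesis using True by (simp add: mod_eq_dvd_iff del: orbit.simps power_Suc)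
next
  case False
  \<comment> \<open>The modulus is even, so the residue determines the parity.\<close>
  have "orbit x0 i mod 2 ^ Suc m \<noteq> orbit x0 j mod 2 ^ Suc m"
  proof
    assume "orbit x0 i mod 2 ^ Suc m = orbit x0 j mod 2 ^ Suc m"
    then have "orbit x0 i mod 2 ^ Suc m mod 2 = orbit x0 j mod 2 ^ Suc m mod 2"
      by (rule arg_cong)
    then show False using False by (simp add: mod_mod_cancel parity_word_def)
  qed
  with False show ?thesis by blast
qed

lemma factor_parity_word_eq_iff:
  "factor (parity_word x0) m i = factor (parity_word x0) m j \<longleftrightarrow>
    orbit x0 i mod 2 ^ m = orbit x0 j mod 2 ^ m"
proof (induction m arbitrary: i j)
  case 0
  show ?case by (simp add: factor_def)
next
  case (Suc m)
  show ?case unfolding orbit_mod_Suc_iff factor_Suc by (simp add: Suc.IH del: orbit.simps)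
qed

text \<open>Sending \<open>f i\<close> to \<open>g i\<close> is well defined and injective because
  the kernels agree.\<close>

lemma card_range_eq_if_same_kernel:
  assumes "\<And>i j. f i = f j \<longleftrightarrow> g i = g j"
  shows "card (range f) = card (range g)"
proof (rule bij_betw_same_card)
  \<comment> \<open>The chosen preimage may differ from \<open>i\<close>, but \<open>f\<close> and
    hence \<open>g\<close> cannot tell them apart.\<close>
  have eq: "g (inv f (f i)) = g i" for i
    using assms by (metis f_inv_into_f rangeI)
  show "bij_betw (g \<circ> inv f) (range f) (range g)"
    unfolding bij_betw_def inj_on_def by (auto simp: eq assms image_comp comp_def)
qed

theorem proposition4p3:
  fixes x0 :: int and m :: nat
  assumes "x0 \<ge> 1"
  shows "complexity (parity_word x0) m = card {orbit x0 n mod 2 ^ m | n. True}"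
  using card_range_eq_if_same_kernel[OF factor_parity_word_eq_iff]
  by (simp add: complexity_def full_SetCompr_eq)

end
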